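(* Let $\mathcal{P}$ be a one-dimensional pattern with weights. Then there exists a finite set $A\subset\mathbb{C}$ and a word $\mathbf{w}:\mathbb{Z}\to A$ that is not identically zero such that \[\sum_{(x,g_x)\in F}\mathbf{w}(x)\,g_x=0\quad\text{for all } F\in\mathcal{P}\] if and only if there exists a positive integer $n$ such that $\mathrm{Poly}_{\mathcal{P}}(x)$ is divisible by the $n$-th cyclotomic polynomial $\Phi_n(x)=\prod_{1\le k\le n,\ \gcd(k,n)=1}(x-e^{2\pi i k/n})$ in $\mathbb{Q}[x]$.
   Context: A figure with weights in $\mathbb{Z}$ is a finite set $\{(u,g_u): u\in F, g_u\in\mathbb{Z}\}$ with $F\subset\mathbb{Z}$ finite. A pattern with weights is the set of all integer translates (points shifted, weights kept) of a fixed figure with weights. The canonical figure $F_{\mathcal{P}}$ of $\mathcal{P}$ is the member of $\mathcal{P}$ whose points are all nonnegative with minimal point $0$. The polynomial of the pattern is $\mathrm{Poly}_{\mathcal{P}}(x)=\sum_{(t,g_t)\in F_{\mathcal{P}}} g_t x^t$. *)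

theory Defs
  imports Complex_Main "HOL-Computational_Algebra.Polynomial"
begin

text \<open>A figure with weights is the graph of an integer-valued function on a finite set of
  points, so \<^const>\<open>Domain\<close> is its set of points. It is required to be nonempty: the
  empty figure has no minimal point, hence its pattern would have no canonical figure.
  The weight zero is allowed.\<close>

definition weighted_figure :: "(int \<times> int) set \<Rightarrow> bool" where
  "weighted_figure F \<longleftrightarrow> finite F \<and> F \<noteq> {} \<and> single_valued F"

definition translate :: "int \<Rightarrow> (int \<times> int) set \<Rightarrow> (int \<times> int) set" where
  "translate t F = (\<lambda>(u, g). (u + t, g)) ` F"

definition weighted_pattern :: "(int \<times> int) set set \<Rightarrow> bool" where
  "weighted_pattern P \<longleftrightarrow> (\<exists>F. weighted_figure F \<and> P = range (\<lambda>t. translate t F))"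

definition is_canonical_figure :: "(int \<times> int) set set \<Rightarrow> (int \<times> int) set \<Rightarrow> bool" where
  "is_canonical_figure P F \<longleftrightarrow> F \<in> P \<and> (\<forall>u\<in>Domain F. 0 \<le> u) \<and> 0 \<in> Domain F"

definition canonical_figure :: "(int \<times> int) set set \<Rightarrow> (int \<times> int) set" where
  "canonical_figure P = (THE F. is_canonical_figure P F)"

lemma canonical_figure_ex1:
  assumes "weighted_pattern P"
  shows "\<exists>!F. is_canonical_figure P F"
proof -
  obtain G where G: "weighted_figure G" and P: "P = range (\<lambda>t. translate t G)"
    using assms unfolding weighted_pattern_def by blast
  have fin: "finite (Domain G)" and ne: "Domain G \<noteq> {}"
    using G unfolding weighted_figure_def by (auto simp: finite_Domain)
  have dom: "Domain (translate t G) = (\<lambda>u. u + t) ` Domain G" for t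
    unfolding translate_def by force
  define m where "m = Min (Domain G)"
  have m: "m \<in> Domain G" "\<forall>u\<in>Domain G. m \<le> u"
    unfolding m_def using fin ne by auto
  have canon: "is_canonical_figure P (translate t G) \<longleftrightarrow> t = - m" for t
    unfolding is_canonical_figure_def dom P using m by force
  show ?thesis
  proof (rule ex1I)
    show "is_canonical_figure P (translate (- m) G)"
      by (simp add: canon)
    show "F = translate (- m) G" if F: "is_canonical_figure P F" for F
    proof -
      obtain t where "F = translate t G"
        using F unfolding is_canonical_figure_def P by blast
      then show ?thesis
        using F canon[of t] by simp
    qed
  qed
qed

definition pattern_poly :: "(int \<times> int) set set \<Rightarrow> int poly" where
  "pattern_poly P = (\<Sum>(t, g)\<in>canonical_figure P. monom g (nat t))"

definition cyclotomic_poly :: "nat \<Rightarrow> complex poly" where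
  "cyclotomic_poly n =
     (\<Prod>k | 1 \<le> k \<and> k \<le> n \<and> coprime k n.
        [:- exp (2 * complex_of_real pi * \<i> * of_nat k / of_nat n), 1:])"

end

theory Submission
  imports Defs "HOL-Computational_Algebra.Computational_Algebra" "HOL-Number_Theory.Cong"
begin

text \<open>A word is annihilated by the pattern iff it satisfies the linear recurrence whose
  coefficients are those of the pattern polynomial \<open>p\<close>. If \<open>p\<close> vanishes at a primitive \<open>n\<close>-th
  root of unity \<open>z\<close>, the word \<open>x \<mapsto> z^x\<close> takes at most \<open>n\<close> values and is annihilated. Conversely,
  by the pigeonhole principle a finitely valued solution is periodic (if \<open>p\<close> is nonzero), and a
  nonzero Fourier coefficient of it yields a root of unity at which \<open>p\<close> vanishes. By the
  irreducibility of cyclotomic polynomials, \<open>p\<close> is then divisible by one of them; irreducibility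
  is obtained from Landau's proof that a monic integer divisor of \<open>x^n - 1\<close> has with a root \<open>z\<close>
  also all roots \<open>z^k\<close> with \<open>k\<close> coprime to \<open>n\<close>.\<close>

section \<open>Integer polynomials at complex points and their minimal polynomials\<close>

lemma map_poly_of_int_mult:
  "map_poly of_int (p * q) = (map_poly of_int p * map_poly of_int q :: 'a::comm_ring_1 poly)"
  by (rule poly_eqI) (simp add: coeff_map_poly coeff_mult)

lemma map_poly_of_int_diff:
  "map_poly of_int (p - q) = (map_poly of_int p - map_poly of_int q :: 'a::comm_ring_1 poly)"
  by (rule poly_eqI) (simp add: coeff_map_poly)

lemma map_poly_of_int_add:
  "map_poly of_int (p + q) = (map_poly of_int p + map_poly of_int q :: 'a::comm_ring_1 poly)"
  by (rule poly_eqI) (simp add: coeff_map_poly)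

text \<open>Polynomials stay over the integers, where contents and congruences modulo primes make
  sense, while their roots are complex.\<close>

definition ipoly :: "int poly \<Rightarrow> complex \<Rightarrow> complex" where
  "ipoly p z = poly (map_poly of_int p) z"

lemma ipoly_simps [simp]:
  "ipoly 0 z = 0" "ipoly 1 z = 1"
  "ipoly (p + q) z = ipoly p z + ipoly q z"
  "ipoly (p - q) z = ipoly p z - ipoly q z"
  "ipoly (p * q) z = ipoly p z * ipoly q z"
  "ipoly (smult c p) z = of_int c * ipoly p z"
  "ipoly (monom c n) z = of_int c * z ^ n"
  "ipoly (pCons c p) z = of_int c + z * ipoly p z"
  by (simp_all add: ipoly_def map_poly_of_int_mult map_poly_of_int_add map_poly_of_int_diff
      map_poly_smult map_poly_monom poly_monom map_poly_pCons)

lemma ipoly_pcompose_monom [simp]: "ipoly (pcompose p (monom 1 k)) z = ipoly p (z ^ k)"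
  by (induction p) (simp_all add: pcompose_pCons)

lemma ipoly_dvd: "f dvd g \<Longrightarrow> ipoly f z = 0 \<Longrightarrow> ipoly g z = 0"
  by (auto elim: dvdE)

text \<open>A primitive polynomial of least degree vanishing at \<open>z\<close> serves as
  \<open>f\<close>: pseudo-division stays over the integers, its remainder is zero by minimality,
  and Gauss's lemma cancels the scalar \<open>a\<close> it introduces.\<close>

lemma minimal_int_poly_exists:
  assumes "g0 \<noteq> 0" "ipoly g0 z = 0"
  obtains f where "f \<noteq> 0" "\<And>g. ipoly g z = 0 \<longleftrightarrow> f dvd g"
proof -
  define S where "S = (\<lambda>f. f \<noteq> 0 \<and> ipoly f z = 0)"
  obtain h where h: "S h" and hmin: "\<And>g. S g \<Longrightarrow> degree h \<le> degree g"
    using exists_least_iff[of "\<lambda>d. \<exists>g. S g \<and> degree g = d"] assms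
    unfolding S_def by (metis linorder_not_less)
  define f where "f = primitive_part h"
  have fh: "smult (content h) f = h" and f0: "f \<noteq> 0" and cf: "content f = 1" and df: "degree f = degree h"
    using h by (auto simp: f_def S_def)
  have "content h \<noteq> 0" using h by (auto simp: S_def)
  have "ipoly (smult (content h) f) z = 0" unfolding fh using h by (simp add: S_def)
  then have fz: "ipoly f z = 0"
    using \<open>content h \<noteq> 0\<close> by simp
  have "f dvd g" if g: "ipoly g z = 0" for g
  proof -
    obtain a q where a: "a \<noteq> 0" and aq: "smult a g = f * q + pseudo_mod g f"
      using pseudo_mod(1)[OF f0, of g] by auto
    have "ipoly (smult a g) z = 0" using g by simp
    then have r: "ipoly (pseudo_mod g f) z = 0" unfolding aq using fz by simp
    have "pseudo_mod g f = 0"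
    proof (rule ccontr)
      assume n: "pseudo_mod g f \<noteq> 0"
      then have "degree (pseudo_mod g f) < degree f" using pseudo_mod(2)[OF f0, of g] by auto
      then show False using hmin[of "pseudo_mod g f"] n r df by (auto simp: S_def)
    qed
    then have e: "smult a g = f * q" using aq by simp
    then have "content (smult a g) = content q" by (simp add: content_mult cf)
    then have "a dvd content q" by (metis content_smult dvd_normalize_iff dvd_refl dvd_mult2)
    then have "[:a:] dvd q" by (simp add: const_poly_dvd_iff_dvd_content)
    then obtain q' where "q = smult a q'" by (auto elim: dvdE)
    then have "smult a (f * q') = smult a g" using e by simp
    then have "f * q' = g" using a by (metis smult_cancel)
    then show ?thesis by auto
  qed
  then show ?thesis using that[of f] f0 fz ipoly_dvd by blast
qed

section \<open>Conjugates of roots of unity\<close>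

text \<open>The inner binomial coefficients are divisible by \<open>p\<close>. The ring is general
  because both \<open>int\<close> and \<open>int poly\<close> occur below.\<close>

lemma freshman_dream_mod:
  fixes a b :: "'a :: comm_ring_1"
  assumes "prime p"
  shows "of_nat p dvd (a + b) ^ p - (a ^ p + b ^ p)"
proof -
  have p: "p > 0" using assms prime_gt_0_nat by blast
  define g where "g = (\<lambda>k. of_nat (p choose k) * a ^ k * b ^ (p - k))"
  have "(a + b) ^ p = (\<Sum>k\<le>p. g k)" unfolding g_def by (rule binomial_ring)
  also have "{..p} = insert 0 (insert p {1..<p})" using p by auto
  also have "(\<Sum>k\<in>\<dots>. g k) = b ^ p + (a ^ p + (\<Sum>k\<in>{1..<p}. g k))"
    using p by (simp add: g_def)
  finally have "(a + b) ^ p - (a ^ p + b ^ p) = (\<Sum>k\<in>{1..<p}. g k)" by simp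
  also have "of_nat p dvd \<dots>"
  proof (rule dvd_sum)
    fix k assume "k \<in> {1..<p}"
    then have "p dvd (p choose k)" using dvd_choose_prime[of k p] assms by auto
    then show "of_nat p dvd g k" unfolding g_def
      by (intro dvd_mult2) (auto elim!: dvdE)
  qed
  finally show ?thesis .
qed

text \<open>By the binomial congruence the claims for \<open>d\<close> and \<open>d + 1\<close> are
  equivalent, so the claim spreads from 0 in both directions.\<close>

lemma fermat_little_int:
  assumes "prime p"
  shows "int p dvd c ^ p - c"
proof -
  have p: "p > 0" using assms prime_gt_0_nat by blast
  have step: "int p dvd (d + 1) ^ p - (d + 1) \<longleftrightarrow> int p dvd d ^ p - d" for d
  proof -
    have "int p dvd ((d + 1) ^ p - (d + 1)) - (d ^ p - d)"
      using freshman_dream_mod[OF assms, of d 1] by (simp add: algebra_simps)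
    then show ?thesis by (metis diff_add_cancel dvd_add_right_iff)
  qed
  show ?thesis
  proof (induction c rule: int_induct[of _ 0])
    case base show ?case using p by (simp add: power_0_left)
  next
    case (step1 i) then show ?case using step by simp
  next
    case (step2 i) then show ?case using step[of "i - 1"] by simp
  qed
qed

text \<open>Frobenius modulo \<open>p\<close>, by induction on the coefficients: the binomial
  congruence splits off the constant term, which Fermat's little theorem handles.\<close>

lemma pcompose_monom_prime:
  fixes f :: "int poly"
  assumes "prime p"
  shows "of_nat p dvd pcompose f (monom 1 p) - f ^ p"
proof (induction f)
  case 0
  then show ?case using assms prime_gt_0_nat by (simp add: power_0_left)
next
  case (pCons c f)
  define X where "X = (monom 1 1 :: int poly)"
  have X: "monom 1 p = X ^ p" by (simp add: X_def monom_power)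
  have pc: "pCons c f = [:c:] + X * f"
    by (simp add: X_def monom_altdef)
  have "of_nat p dvd [:c:] ^ p - [:c:]"
  proof -
    have "of_nat p dvd [:c ^ p - c:]"
      using fermat_little_int[OF assms, of c] unfolding of_nat_poly by simp
    moreover have "[:c ^ p - c:] = [:c:] ^ p - [:c:]" by (simp add: poly_const_pow)
    ultimately show ?thesis by simp
  qed
  moreover have "of_nat p dvd ([:c:] + X * f) ^ p - ([:c:] ^ p + (X * f) ^ p)"
    by (rule freshman_dream_mod[OF assms])
  moreover have "of_nat p dvd X ^ p * (pcompose f (monom 1 p) - f ^ p)"
    using pCons.IH by simp
  ultimately have "of_nat p dvd X ^ p * (pcompose f (monom 1 p) - f ^ p)
     - (([:c:] + X * f) ^ p - ([:c:] ^ p + (X * f) ^ p)) - ([:c:] ^ p - [:c:])"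
    using dvd_diff by blast
  also have "\<dots> = pcompose (pCons c f) (monom 1 p) - pCons c f ^ p"
    unfolding pcompose_pCons X pc[symmetric] by (simp add: algebra_simps power_mult_distrib)
  finally show ?case .
qed

section \<open>Reduction modulo a monic integer polynomial and Landau's argument\<close>

lemma monic_remainder:
  fixes f g :: "'a::{comm_ring_1,semiring_1_no_zero_divisors} poly"
  assumes "lead_coeff f = 1"
  obtains r where "f dvd g - r" "r = 0 \<or> degree r < degree f"
proof -
  have f0: "f \<noteq> 0" using assms by auto
  obtain q r where qr: "pseudo_divmod g f = (q, r)" by force
  \<comment> \<open>Pseudo-division scales \<open>g\<close> by a power of
    \<open>lead_coeff f\<close>, which is 1 here.\<close>
  have "g = f * q + r" using pseudo_divmod(1)[OF f0 qr] assms by simp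
  moreover have "r = 0 \<or> degree r < degree f" using pseudo_divmod(2)[OF f0 qr] .
  ultimately show ?thesis using that[of r] by simp
qed

lemma monic_dvd_small:
  fixes f r :: "'a::idom poly"
  assumes "f dvd r" "r = 0 \<or> degree r < degree f"
  shows "r = 0"
  using assms dvd_imp_degree_le[of f r] by fastforce

text \<open>As \<open>x^n\<close> is 1 modulo \<open>f\<close>, the class of \<open>x^k\<close>, and
  hence that of \<open>g(x^k)\<close>, depends only on \<open>k mod n\<close>.\<close>

lemma dvd_pcompose_monom_cong:
  fixes f g :: "int poly"
  assumes "f dvd monom 1 n - 1"
  shows "f dvd pcompose g (monom 1 (k + n * m)) - pcompose g (monom 1 k)"
proof (induction g)
  case (pCons c g)
  let ?A = "monom 1 (k + n * m) :: int poly" and ?B = "monom 1 k :: int poly"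
  have "?A - ?B = ?B * ((monom 1 n) ^ m - 1)"
    by (simp add: monom_power mult_monom algebra_simps)
  also have "monom 1 n - 1 dvd (monom 1 n :: int poly) ^ m - 1"
    using power_diff_1_eq[of "monom 1 n :: int poly" m] by simp
  ultimately have AB: "f dvd ?A - ?B" using assms by (metis dvd_mult dvd_trans)
  have "pcompose (pCons c g) ?A - pcompose (pCons c g) ?B
      = ?A * (pcompose g ?A - pcompose g ?B) + (?A - ?B) * pcompose g ?B"
    by (simp add: pcompose_pCons algebra_simps)
  then show ?case using AB pCons.IH by simp
qed simp

text \<open>Landau's argument: the remainder of \<open>f(x^p)\<close> modulo \<open>f\<close> depends only on
  \<open>p mod n\<close>, so its coefficients are bounded independently of \<open>p\<close>; since
  \<open>f(x^p)\<close> and \<open>f(x)^p\<close> agree modulo \<open>p\<close>, they are also divisible by \<open>p\<close>.\<close>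

lemma dvd_pcompose_monom_large_prime:
  fixes f :: "int poly"
  assumes f: "lead_coeff f = 1" and n: "n > 0" "f dvd monom 1 n - 1"
  obtains B where "\<And>p. prime p \<Longrightarrow> p > B \<Longrightarrow> f dvd pcompose f (monom 1 p)"
proof -
  have "\<forall>k. \<exists>r. f dvd pcompose f (monom 1 k) - r \<and> (r = 0 \<or> degree r < degree f)"
    using monic_remainder[OF f] by metis
  then obtain r where r1: "\<And>k. f dvd pcompose f (monom 1 k) - r k"
    and r2: "\<And>k. r k = 0 \<or> degree (r k) < degree f" by metis
  define B where "B = Max ((\<lambda>(k, i). nat \<bar>coeff (r k) i\<bar>) ` ({..<n} \<times> {..degree f}))"
  have B: "nat \<bar>coeff (r k) i\<bar> \<le> B" if "k < n" "i \<le> degree f" for k i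
    unfolding B_def using that by (intro Max_ge) auto
  have "f dvd pcompose f (monom 1 p)" if p: "prime p" "p > B" for p
  proof -
    define k where "k = p mod n"
    have kn: "k < n" using n by (simp add: k_def)
    have "p = k + n * (p div n)" by (simp add: k_def)
    then have "f dvd pcompose f (monom 1 p) - pcompose f (monom 1 k)"
      using dvd_pcompose_monom_cong[OF n(2)] by metis
    from dvd_add[OF this r1[of k]] have d1: "f dvd pcompose f (monom 1 p) - r k" by simp
    obtain s where s: "pcompose f (monom 1 p) - f ^ p = of_nat p * s"
      using pcompose_monom_prime[OF p(1), of f] by (auto elim: dvdE)
    obtain t where t: "f dvd s - t" "t = 0 \<or> degree t < degree f"
      using monic_remainder[OF f] by blast
    have "f dvd f ^ p" using p(1) by (simp add: dvd_power prime_gt_0_nat)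
    \<comment> \<open>Two remainders of \<open>f(x^p)\<close> modulo \<open>f\<close> are compared:
      \<open>r k\<close>, and \<open>p * t\<close> coming from \<open>f(x^p) = f^p + p * s\<close>.
      Each is zero or of degree below that of \<open>f\<close>, so they coincide.\<close>
    have "f dvd (pcompose f (monom 1 p) - r k) - f ^ p - of_nat p * (s - t)"
      by (intro dvd_diff dvd_mult d1 t(1) \<open>f dvd f ^ p\<close>)
    also have "\<dots> = of_nat p * t - r k"
      using s by (simp add: algebra_simps)
    finally have d2: "f dvd of_nat p * t - r k" .
    have "of_nat p * t - r k = 0"
    proof (rule monic_dvd_small[OF d2])
      have "of_nat p * t = 0 \<or> degree (of_nat p * t) < degree f"
        using t(2) degree_mult_le[of "of_nat p" t] by auto
      then show "of_nat p * t - r k = 0 \<or> degree (of_nat p * t - r k) < degree f"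
        using r2[of k] degree_diff_less[of "of_nat p * t" "degree f" "r k"] 
        by auto
    qed
    then have rk: "r k = smult (int p) t" by (simp add: of_nat_poly)
    have "r k = 0"
    proof (rule poly_eqI)
      fix i
      show "coeff (r k) i = coeff 0 i"
      proof (cases "i \<le> degree f")
        case True
        have "int p dvd coeff (r k) i" by (simp add: rk)
        moreover have "\<bar>coeff (r k) i\<bar> < int p" using B[OF kn True] p(2) by linarith
        ultimately show ?thesis using zdvd_not_zless[of "\<bar>coeff (r k) i\<bar>" "int p"] by auto
      next
        case False
        then show ?thesis using r2[of k] by (auto simp: coeff_eq_0)
      qed
    qed
    then show ?thesis using d1 by simp
  qed
  then show ?thesis using that by blast
qed

text \<open>Take \<open>m\<close> to be the product of the primes up to \<open>B\<close> not
  dividing \<open>k\<close>. Then a prime up to \<open>B\<close> divides exactly one of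
  \<open>k\<close> and \<open>n * m\<close>, so it does not divide their sum.\<close>

lemma coprime_large_prime_factors:
  fixes k n B :: nat
  assumes "coprime k n" "n > 0"
  obtains m where "m > 0" "\<And>p. prime p \<Longrightarrow> p dvd k + n * m \<Longrightarrow> p > B"
proof -
  define S where "S = {q. prime q \<and> q \<le> B \<and> \<not> q dvd k}"
  have fin: "finite S" unfolding S_def by simp
  define m where "m = \<Prod>S"
  have "p > B" if p: "prime p" "p dvd k + n * m" for p
  proof (rule ccontr)
    assume "\<not> p > B"
    then have pB: "p \<le> B" by simp
    show False
    proof (cases "p dvd k")
      case True
      then have "p dvd n * m" using p(2) by (simp add: dvd_add_right_iff)
      moreover have "\<not> p dvd n" using assms True p(1)
        by (meson coprime_common_divisor not_prime_unit)
      ultimately have "p dvd m" using p(1) by (simp add: prime_dvd_mult_iff)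
      then obtain q where "q \<in> S" "p dvd q" unfolding m_def
        using prime_dvd_prod_iff[OF fin p(1), of "\<lambda>q. q"] by auto
      then have "p = q" using p(1) by (simp add: S_def primes_dvd_imp_eq)
      then show False using True \<open>q \<in> S\<close> by (simp add: S_def)
    next
      case False
      then have "p \<in> S" using p(1) pB by (simp add: S_def)
      then have "p dvd m" unfolding m_def using dvd_prodI[OF fin, of p "\<lambda>q. q"] by simp
      then show False using False p(2) by (simp add: dvd_add_left_iff)
    qed
  qed
  moreover have "m > 0" unfolding m_def S_def by (auto intro!: prod_pos prime_gt_0_nat)
  ultimately show ?thesis using that by blast
qed

text \<open>Since \<open>z ^ n = 1\<close>, the exponent \<open>k\<close> may be changed modulo
  \<open>n\<close> to one with only large prime factors. Raising to each of these primes in turn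
  sends roots of \<open>f\<close> to roots of \<open>f\<close>.\<close>

lemma root_power_coprime:
  assumes f: "lead_coeff f = 1" and n: "n > 0" "f dvd monom 1 n - 1"
    and z: "ipoly f z = 0" and k: "coprime k n"
  shows "ipoly f (z ^ k) = 0"
proof -
  obtain B where B: "\<And>p. prime p \<Longrightarrow> p > B \<Longrightarrow> f dvd pcompose f (monom 1 p)"
    using dvd_pcompose_monom_large_prime[OF f n] by blast
  have *: "ipoly f (y ^ m) = 0" if "ipoly f y = 0" "m > 0" "\<And>p. prime p \<Longrightarrow> p dvd m \<Longrightarrow> p > B" for y m
    using that
  proof (induction m arbitrary: y rule: prime_divisors_induct)
    case (factor p m)
    have "ipoly (pcompose f (monom 1 p)) y = 0"
      by (rule ipoly_dvd[OF B factor.prems(1)]) (use factor in auto)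
    then have "ipoly f ((y ^ p) ^ m) = 0"
      using factor by (intro factor.IH) auto
    then show ?case by (simp add: power_mult)
  qed auto
  obtain m where m: "m > 0" "\<And>p. prime p \<Longrightarrow> p dvd k + n * m \<Longrightarrow> p > B"
    using coprime_large_prime_factors[OF k n(1)] by blast
  have "z ^ n = 1" using ipoly_dvd[OF n(2) z] by simp
  then have "z ^ (k + n * m) = z ^ k" by (simp add: power_add power_mult)
  then show ?thesis using *[OF z, of "k + n * m"] m n by simp
qed

text \<open>A divisor of the monic \<open>x^n - 1\<close> has leading coefficient 1 or -1, so a
  change of sign makes the minimal polynomial monic.\<close>

lemma minimal_int_poly_root_of_unity:
  assumes "n > 0" "z ^ n = 1"
  obtains f where "lead_coeff f = 1" "\<And>g. ipoly g z = 0 \<longleftrightarrow> f dvd g"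
proof -
  have "coeff (monom 1 n - 1 :: int poly) n = 1" using assms by simp
  then have lc: "lead_coeff (monom 1 n - 1 :: int poly) = 1" and "monom 1 n - 1 \<noteq> (0 :: int poly)"
    using assms degree_diff_le[of "monom 1 n :: int poly" n 1] le_degree[of "monom 1 n - 1 :: int poly" n]
    by (auto simp: degree_monom_eq le_antisym)
  moreover have "ipoly (monom 1 n - 1) z = 0" using assms by simp
  ultimately obtain f where f: "f \<noteq> 0" "\<And>g. ipoly g z = 0 \<longleftrightarrow> f dvd g"
    using minimal_int_poly_exists by blast
  then have "f dvd monom 1 n - 1" using \<open>ipoly (monom 1 n - 1) z = 0\<close> by blast
  then have "lead_coeff f dvd 1" using lc by (metis dvdE dvd_triv_left lead_coeff_mult)
  then have "lead_coeff f = 1 \<or> lead_coeff (- f) = 1" by auto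
  then show ?thesis using that[of f] that[of "- f"] f by auto
qed

section \<open>Cyclotomic polynomials\<close>

definition prim_root :: "nat \<Rightarrow> complex" where
  "prim_root n = cis (2 * pi / real n)"

lemma prim_root_power: "prim_root n ^ k = cis (2 * pi * real k / real n)"
  by (simp add: prim_root_def DeMoivre mult_ac)

lemma power_mod_eq:
  fixes z :: "'a::monoid_mult"
  assumes "z ^ n = 1"
  shows "z ^ (k mod n) = z ^ k"
proof -
  have "z ^ k = z ^ (n * (k div n) + k mod n)" by simp
  also have "\<dots> = z ^ (k mod n)" by (simp only: power_add power_mult assms) simp
  finally show ?thesis by simp
qed

lemma prim_root_power_eq_1_iff:
  assumes "n > 0"
  shows "prim_root n ^ k = 1 \<longleftrightarrow> n dvd k"
proof -
  have n1: "prim_root n ^ n = 1" using assms by (simp add: prim_root_power)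
  have "prim_root n ^ k = 1 \<longleftrightarrow> prim_root n ^ (k mod n) = prim_root n ^ 0"
    by (simp add: power_mod_eq[OF n1])
  also have "\<dots> \<longleftrightarrow> k mod n = 0"
    using inj_on_eq_iff[OF bij_betw_imp_inj_on[OF bij_betw_roots_unity[OF assms]], of "k mod n" 0] assms
    by (simp add: prim_root_power)
  finally show ?thesis by (simp add: dvd_eq_mod_eq_0)
qed

lemma prim_root_neq_0 [simp]: "prim_root n \<noteq> 0"
  by (simp add: prim_root_def)

lemma root_of_unity_eq_prim_root_power:
  assumes "n > 0" "z ^ n = 1"
  obtains k where "k < n" "z = prim_root n ^ k"
  using bij_betw_imp_surj_on[OF bij_betw_roots_unity[OF assms(1)]] assms(2)
  by (force simp: prim_root_power)

text \<open>For \<open>z = prim_root N ^ j\<close>, the fraction \<open>j / N\<close> is reduced to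
  lowest terms \<open>k / n\<close>.\<close>

lemma root_of_unity_primitive:
  assumes "N > 0" "z ^ N = 1"
  obtains n k where "n > 0" "coprime k n" "z = prim_root n ^ k"
proof -
  obtain j where j: "z = prim_root N ^ j" using root_of_unity_eq_prim_root_power[OF assms] by blast
  define d where "d = gcd j N"
  have d: "d > 0" using assms by (simp add: d_def)
  then obtain k n where k: "j = k * d" and n: "N = n * d" and "coprime k n"
    using gcd_coprime_exists[of j N] unfolding d_def by auto
  moreover have "z = prim_root n ^ k" using d by (simp add: j prim_root_power k n mult.assoc)
  moreover have "n > 0" using assms n by simp
  ultimately show ?thesis using that by blast
qed

text \<open>A product over the set of roots is the form in which a squarefree polynomial factors;
  \<open>k\<close> may be unbounded because the powers depend only on
  \<open>k mod n\<close>.\<close>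

lemma cyclotomic_poly_altdef:
  assumes n: "n > 0"
  shows "cyclotomic_poly n = (\<Prod>z \<in> (\<lambda>k. prim_root n ^ k) ` {k. coprime k n}. [:- z, 1:])"
proof -
  let ?S = "{k. 1 \<le> k \<and> k \<le> n \<and> coprime k n}"
  have pos: "k \<le> l \<Longrightarrow> 1 \<le> k \<Longrightarrow> l \<le> n \<Longrightarrow> prim_root n ^ k = prim_root n ^ l \<Longrightarrow> k = l" for k l
  proof -
    assume kl: "k \<le> l" "1 \<le> k" "l \<le> n" "prim_root n ^ k = prim_root n ^ l"
    then have "prim_root n ^ k * 1 = prim_root n ^ k * prim_root n ^ (l - k)"
      by (metis le_add_diff_inverse mult.right_neutral power_add)
    then have "prim_root n ^ (l - k) = 1" by simp
    then have "n dvd l - k" using prim_root_power_eq_1_iff[OF n] by blast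
    moreover have "l - k < n" using kl by linarith
    ultimately show "k = l" using kl(1) by (auto dest: dvd_imp_le)
  qed
  have inj: "inj_on (\<lambda>k. prim_root n ^ k) ?S"
  proof (rule inj_onI)
    fix k l assume "k \<in> ?S" "l \<in> ?S" "prim_root n ^ k = prim_root n ^ l"
    then show "k = l" using pos[of k l] pos[of l k] by (cases "k \<le> l") auto
  qed
  have "cyclotomic_poly n = (\<Prod>k\<in>?S. [:- (prim_root n ^ k), 1:])"
    unfolding cyclotomic_poly_def
    by (rule prod.cong) (simp_all add: prim_root_power cis_conv_exp mult_ac)
  also have "\<dots> = (\<Prod>z \<in> (\<lambda>k. prim_root n ^ k) ` ?S. [:- z, 1:])"
    by (rule prod.reindex_cong[OF inj refl refl, symmetric])
  also have "(\<lambda>k. prim_root n ^ k) ` ?S = (\<lambda>k. prim_root n ^ k) ` {k. coprime k n}"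
  proof (intro equalityI subsetI)
    fix z assume "z \<in> (\<lambda>k. prim_root n ^ k) ` {k. coprime k n}"
    then obtain k where k: "coprime k n" "z = prim_root n ^ k" by blast
    \<comment> \<open>The representative of \<open>k\<close> in \<open>1..n\<close>; residue 0 is
      coprime to \<open>n\<close> only for \<open>n = 1\<close>, where \<open>l = 1\<close>.\<close>
    define l where "l = (if k mod n = 0 then n else k mod n)"
    have "l \<in> ?S"
    proof (cases "k mod n = 0")
      case True
      then have "n dvd k" by auto
      then have "n = 1" using coprime_common_divisor[OF k(1), of n] by simp
      then show ?thesis by (simp add: l_def)
    next
      case False
      then show ?thesis using k(1) n by (auto simp: l_def coprime_mod_left_iff Suc_le_eq less_imp_le)
    qed
    moreover have "z = prim_root n ^ l"
    proof -
      have n1: "prim_root n ^ n = 1" using n by (simp add: prim_root_power)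
      then show ?thesis using power_mod_eq[OF n1, of k] k by (auto simp: l_def)
    qed
    ultimately show "z \<in> (\<lambda>k. prim_root n ^ k) ` ?S" by blast
  qed auto
  finally show ?thesis .
qed

text \<open>Here \<open>f\<close> is the minimal polynomial of \<open>prim_root n\<close>. Its
  dividing every \<open>g\<close> that vanishes at any one primitive root expresses the
  irreducibility of the cyclotomic polynomial.\<close>

lemma cyclotomic_minimal_poly:
  assumes n: "n > 0"
  obtains f where "map_poly of_int f = cyclotomic_poly n"
    "\<And>g k. coprime k n \<Longrightarrow> ipoly g (prim_root n ^ k) = 0 \<Longrightarrow> f dvd g"
proof -
  let ?z = "prim_root n"
  have z1: "?z ^ n = 1" using n by (simp add: prim_root_power)
  obtain f where f: "lead_coeff f = 1" and fdvd: "\<And>g. ipoly g ?z = 0 \<longleftrightarrow> f dvd g"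
    using minimal_int_poly_root_of_unity[OF n z1] by blast
  have fn: "f dvd monom 1 n - 1" unfolding fdvd[symmetric] using z1 by simp
  have f0: "ipoly f ?z = 0" by (simp add: fdvd)
  have roots1: "ipoly f (?z ^ k) = 0" if "coprime k n" for k
    by (rule root_power_coprime[OF f n fn f0 that])
  have dvd: "f dvd g" if k: "coprime k n" "ipoly g (?z ^ k) = 0" for g k
  proof -
    have zk: "(?z ^ k) ^ n = 1" using power_mult[of ?z k n] power_mult[of ?z n k] z1
      by (simp add: mult.commute[of n k])
    obtain h where h: "lead_coeff h = 1" and hdvd: "\<And>g. ipoly g (?z ^ k) = 0 \<longleftrightarrow> h dvd g"
      using minimal_int_poly_root_of_unity[OF n zk] by blast
    \<comment> \<open>An inverse of \<open>k\<close> modulo \<open>n\<close> leads back from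
      \<open>?z ^ k\<close> to \<open>?z\<close>, so \<open>h\<close> vanishes at \<open>?z\<close>
      too.\<close>
    obtain l where l: "[k * l = 1] (mod n)" using cong_solve_coprime_nat[OF k(1)] by auto
    then have "coprime (k * l) n" using cong_imp_coprime[of 1 "k * l" n] cong_sym by force
    then have "coprime l n" by simp
    have hn: "h dvd monom 1 n - 1" unfolding hdvd[symmetric] using zk by simp
    have "ipoly h (?z ^ k) = 0" by (simp add: hdvd)
    from root_power_coprime[OF h n hn this \<open>coprime l n\<close>]
    have "ipoly h ((?z ^ k) ^ l) = 0" .
    also have "(?z ^ k) ^ l = ?z ^ (k * l)" by (simp add: power_mult)
    also have "\<dots> = ?z"
    proof -
      have "?z ^ (k * l) = ?z ^ ((k * l) mod n)" by (rule power_mod_eq[OF z1, symmetric])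
      also have "\<dots> = ?z ^ (1 mod n)" using l by (simp add: cong_def)
      also have "\<dots> = ?z ^ 1" by (rule power_mod_eq[OF z1])
      finally show ?thesis by simp
    qed
    finally have "f dvd h" by (simp add: fdvd)
    moreover have "h dvd g" using k(2) by (simp add: hdvd)
    ultimately show ?thesis by (rule dvd_trans)
  qed
  \<comment> \<open>If \<open>y\<close> were not primitive, then \<open>y ^ m = 1\<close> with
    \<open>0 < m < n\<close>, so the minimal polynomial \<open>h\<close> of \<open>y\<close> would
    divide \<open>x^m - 1\<close> and not vanish at \<open>?z\<close>. In \<open>f = h * q\<close>
    the factor \<open>q\<close> would then vanish there and be a multiple of \<open>f\<close>,
    making \<open>h\<close> a unit.\<close>
  have roots2: "\<exists>k. coprime k n \<and> y = ?z ^ k" if y: "ipoly f y = 0" for y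
  proof -
    have yn: "y ^ n = 1" using ipoly_dvd[OF fn y] by simp
    obtain j where j: "y = ?z ^ j" using root_of_unity_eq_prim_root_power[OF n yn] by blast
    have "coprime j n"
    proof (rule ccontr)
      assume "\<not> coprime j n"
      then have "gcd j n \<noteq> 1" "gcd j n > 0" using n by (auto simp: coprime_iff_gcd_eq_1)
      then have g1: "gcd j n > 1" by linarith
      define m where "m = n div gcd j n"
      have m: "n = m * gcd j n" by (simp add: m_def)
      then have "m > 0" using n by (metis mult_0 neq0_conv)
      then have m0: "m > 0" "m < n" using g1 m n_less_m_mult_n[of m "gcd j n"] by (simp_all add: mult.commute)
      have "n dvd j * m"
        using mult_dvd_mono[OF gcd_dvd1[of j n] dvd_refl[of m]] m by (simp add: mult.commute)
      then have ym: "y ^ m = 1"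
        using prim_root_power_eq_1_iff[OF n, of "j * m"] by (simp add: j power_mult)
      obtain h where hdvd: "\<And>g. ipoly g y = 0 \<longleftrightarrow> h dvd g"
        using minimal_int_poly_root_of_unity[OF n yn] by blast
      have "h dvd monom 1 m - 1" unfolding hdvd[symmetric] using ym by simp
      moreover have "ipoly (monom 1 m - 1) ?z \<noteq> 0"
        using prim_root_power_eq_1_iff[OF n, of m] m0 by (auto dest: dvd_imp_le)
      ultimately have hz: "ipoly h ?z \<noteq> 0" using ipoly_dvd by blast
      obtain q where q: "f = h * q" using hdvd y by blast
      then have "ipoly q ?z = 0" using f0 hz by simp
      then obtain r where r: "q = f * r" using fdvd by blast
      have "f * (h * r) = f * 1" using q r by (simp add: ac_simps)
      moreover have "f \<noteq> 0" using f by auto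
      ultimately have "h * r = 1" using mult_left_cancel by blast
      then have "h dvd 1" by (rule dvdI[OF sym])
      then show False using hdvd[of 1] by simp
    qed
    then show ?thesis using j by blast
  qed
  define F where "F = (map_poly of_int f :: complex poly)"
  \<comment> \<open>A double root of \<open>F\<close> would be one of \<open>x^n - 1\<close>, whose
    derivative vanishes at most at 0.\<close>
  have "rsquarefree F"
    unfolding rsquarefree_roots
  proof (intro allI notI, elim conjE)
    fix a assume a: "poly F a = 0" "poly (pderiv F) a = 0"
    obtain q where q: "monom 1 n - 1 = f * q" using fn by blast
    define Q where "Q = (map_poly of_int q :: complex poly)"
    have "map_poly of_int (monom 1 n - 1) = F * Q"
      unfolding q F_def Q_def by (rule map_poly_of_int_mult)
    then have FQ: "monom 1 n - 1 = F * Q"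
      by (simp add: map_poly_of_int_diff map_poly_monom)
    have "poly (monom 1 n - 1) a = 0" unfolding FQ using a by simp
    then have "a ^ n = 1" by (simp add: poly_monom)
    have "poly (pderiv (monom 1 n - 1)) a = 0" unfolding FQ using a by (simp add: pderiv_mult)
    then have "of_nat n * a ^ (n - 1) = 0" by (simp add: pderiv_diff pderiv_monom poly_monom)
    then have "a = 0" using n by auto
    then show False using \<open>a ^ n = 1\<close> n by (simp add: power_0_left)
  qed
  moreover have "lead_coeff F = 1"
    using f unfolding F_def by (subst lead_coeff_map_poly_nz) auto
  ultimately have "F = (\<Prod>z | poly F z = 0. [:- z, 1:])"
    using complex_poly_decompose_rsquarefree[of F] by simp
  also have "{z. poly F z = 0} = (\<lambda>k. ?z ^ k) ` {k. coprime k n}"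
    using roots1 roots2 unfolding F_def ipoly_def by blast
  finally have "F = cyclotomic_poly n" by (simp add: cyclotomic_poly_altdef[OF n])
  then show ?thesis using that[of f] dvd unfolding F_def by blast
qed

section \<open>Words annihilated by a pattern\<close>

text \<open>Factors \<open>x\<close> of \<open>p\<close> are removed by shifting. Once the constant
  coefficient is nonzero, it extends a window of zeros to the left, and the leading coefficient
  extends it to the right.\<close>

lemma recurrence_zero:
  fixes u :: "int \<Rightarrow> 'a::field" and p :: "'a poly"
  assumes "p \<noteq> 0"
    and "\<And>s. (\<Sum>i\<le>degree p. coeff p i * u (s + int i)) = 0"
    and "\<And>i. i \<le> degree p \<Longrightarrow> u (s0 + int i) = 0"
  shows "u s = 0"
  using assms
proof (induction p arbitrary: s0 s)
  case 0
  then show ?case by simp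
next
  case (pCons c p)
  show ?case
  proof (cases "c = 0")
    case True
    then have p0: "p \<noteq> 0" using pCons.hyps by simp
    then have d: "degree (pCons c p) = Suc (degree p)" by simp
    show ?thesis
    proof (rule pCons.IH[OF p0])
      fix s
      \<comment> \<open>With \<open>c = 0\<close>, the recurrence of \<open>pCons c p\<close> at
        \<open>s - 1\<close> is that of \<open>p\<close> at \<open>s\<close>.\<close>
      show "(\<Sum>i\<le>degree p. coeff p i * u (s + int i)) = 0"
        using pCons.prems(2)[of "s - 1"] True unfolding d
        by (simp add: sum.atMost_Suc_shift del: sum.atMost_Suc)
      show "u (s0 + int i) = 0" if "i \<le> degree p" for i
        using pCons.prems(3)[of i] that unfolding d by simp
    qed
  next
    case False
    define q where "q = pCons c p"
    define D where "D = degree q"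
    have lc: "coeff q D \<noteq> 0" and c0: "coeff q 0 \<noteq> 0"
      using pCons.prems(1) False by (auto simp: q_def D_def)
    have rec: "(\<Sum>i\<le>D. coeff q i * u (s + int i)) = 0" for s
      using pCons.prems(2)[of s] by (simp add: q_def D_def)
    have all: "\<forall>i\<le>D. u (t + int i) = 0" for t
    proof (induction t rule: int_induct[of _ s0])
      case base
      then show ?case using pCons.prems(3) by (simp add: q_def D_def)
    next
      case (step1 t)
      have low: "u (t + 1 + int i) = 0" if "i < D" for i
        using step1(2)[rule_format, of "Suc i"] that by (simp add: add_ac)
      have "(\<Sum>i\<le>D. coeff q i * u (t + 1 + int i)) = coeff q D * u (t + 1 + int D)"
        using low by (subst sum.remove[of _ D]) (auto intro!: sum.neutral)
      then have "u (t + 1 + int D) = 0" using rec[of "t + 1"] lc by simp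
      then show ?case using low le_neq_implies_less by blast
    next
      case (step2 t)
      have high: "u (t - 1 + int i) = 0" if "i \<noteq> 0" "i \<le> D" for i
        using step2(2)[rule_format, of "i - 1"] that by (simp add: of_nat_diff algebra_simps)
      have "(\<Sum>i\<le>D. coeff q i * u (t - 1 + int i)) = coeff q 0 * u (t - 1 + int 0)"
        using high by (subst sum.remove[of _ 0]) (auto intro!: sum.neutral)
      then have "u (t - 1 + int 0) = 0" using rec[of "t - 1"] c0 by simp
      then show ?case using high by (metis)
    qed
    then show ?thesis using all[of s, rule_format, of 0] by simp
  qed
qed

text \<open>By pigeonhole two windows of \<open>degree p + 1\<close> values agree. The word shifted
  by their distance, minus the word itself, solves the recurrence and vanishes on a window, hence
  everywhere.\<close>

lemma recurrence_periodic:
  fixes w :: "int \<Rightarrow> 'a::field" and p :: "'a poly"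
  assumes fin: "finite (range w)" and p: "p \<noteq> 0"
    and rec: "\<And>s. (\<Sum>i\<le>degree p. coeff p i * w (s + int i)) = 0"
  obtains N where "N > 0" "\<And>s. w (s + int N) = w s"
proof -
  define win where "win = (\<lambda>s::nat. map (\<lambda>i. w (int s + int i)) [0..<Suc (degree p)])"
  have "range win \<subseteq> {xs. set xs \<subseteq> range w \<and> length xs = Suc (degree p)}"
    by (auto simp: win_def)
  then have "finite (range win)"
    using finite_lists_length_eq[OF fin] finite_subset by blast
  then have "\<not> inj win" using finite_imageD[of win UNIV] by auto
  then obtain x y where xy: "x < y" "win x = win y"
    unfolding inj_def by (metis linorder_neqE_nat)
  define u where "u = (\<lambda>s. w (s + int (y - x)) - w s)"
  have "u s = 0" for s
  proof (rule recurrence_zero[OF p])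
    fix s
    have "(\<Sum>i\<le>degree p. coeff p i * u (s + int i))
      = (\<Sum>i\<le>degree p. coeff p i * w ((s + int (y - x)) + int i)) - (\<Sum>i\<le>degree p. coeff p i * w (s + int i))"
      by (simp add: u_def algebra_simps sum_subtractf)
    then show "(\<Sum>i\<le>degree p. coeff p i * u (s + int i)) = 0" by (simp add: rec)
  next
    fix i assume "i \<le> degree p"
    then have "win x ! i = w (int x + int i)" "win y ! i = w (int y + int i)"
      unfolding win_def by (simp_all del: upt_Suc)
    then show "u (int x + int i) = 0" using xy by (simp add: u_def algebra_simps of_nat_diff)
  qed
  then show ?thesis using that[of "y - x"] xy by (simp add: u_def)
qed

lemma periodic_int_mult:
  fixes w :: "int \<Rightarrow> 'a"
  assumes "\<And>s. w (s + N) = w s"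
  shows "w (s + k * N) = w s"
proof (induction k rule: int_induct[of _ 0])
  case (step1 i)
  then show ?case using assms[of "s + i * N"] by (simp add: algebra_simps)
next
  case (step2 i)
  then show ?case using assms[of "s + (i - 1) * N"] by (simp add: algebra_simps)
qed simp

text \<open>With \<open>W\<close> the generating polynomial of one period, the recurrence says that
  \<open>p(1/y) W(y) = 0\<close> at every \<open>N\<close>-th root of unity \<open>y\<close>; as \<open>degree W < N\<close>, \<open>W\<close> cannot vanish at
  all of them.\<close>

lemma periodic_recurrence_root_of_unity:
  fixes w :: "int \<Rightarrow> complex" and p :: "complex poly"
  assumes N: "N > 0" and per: "\<And>s. w (s + int N) = w s" and x: "w x \<noteq> 0"
    and rec: "\<And>s. (\<Sum>i\<le>degree p. coeff p i * w (s + int i)) = 0"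
  obtains z where "z ^ N = 1" "poly p z = 0"
proof -
  define W where "W = (\<Sum>k<N. monom (w (int k)) k)"
  have coeffW: "coeff W k = (if k < N then w (int k) else 0)" for k
    by (simp add: W_def coeff_sum)
  have "w (x mod int N) \<noteq> 0"
    using x periodic_int_mult[of w "int N" "x mod int N" "x div int N", OF per]
    by (metis mod_mult_div_eq mult.commute)
  then have "coeff W (nat (x mod int N)) \<noteq> 0"
    using N by (simp add: coeffW nat_less_iff)
  then have W0: "W \<noteq> 0" by auto
  have degW: "degree W < N"
    using coeffW W0 by (metis leading_coeff_0_iff)
  have "\<exists>y. y ^ N = 1 \<and> poly W y \<noteq> 0"
  proof (rule ccontr)
    assume "\<not> ?thesis"
    then have "{y. y ^ N = 1} \<subseteq> {y. poly W y = 0}" by auto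
    then have "card {y::complex. y ^ N = 1} \<le> card {y. poly W y = 0}"
      by (intro card_mono poly_roots_finite W0)
    then show False using card_roots_unity_eq[OF N] card_poly_roots_bound[OF W0] degW by simp
  qed
  then obtain y where y: "y ^ N = 1" "poly W y \<noteq> 0" by blast
  have y0: "y \<noteq> 0" using y N by (auto simp: power_0_left)
  have Wy: "poly W y = (\<Sum>k<N. w (int k) * y ^ k)"
    by (simp add: W_def poly_sum poly_monom)
  \<comment> \<open>Shifting the word by \<open>i\<close> divides its Fourier sum by
    \<open>y ^ i\<close>: the boundary terms \<open>h N\<close> and \<open>h 0\<close> agree by
    periodicity and \<open>y ^ N = 1\<close>.\<close>
  have shift: "y ^ i * (\<Sum>k<N. w (int k + int i) * y ^ k) = poly W y" for i
  proof (induction i)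
    case 0
    then show ?case by (simp add: Wy)
  next
    case (Suc i)
    define h where "h = (\<lambda>k. w (int k + int i) * y ^ k)"
    have "y * (\<Sum>k<N. w (int k + int (Suc i)) * y ^ k) = (\<Sum>k<N. h (Suc k))"
      by (simp add: sum_distrib_left h_def algebra_simps)
    also have "\<dots> = (\<Sum>k<N. h k) + h N - h 0"
      using sum.lessThan_Suc_shift[of h N] by simp
    also have "h N = h 0" using per[of "int i"] y by (simp add: h_def add.commute)
    finally have "y * (\<Sum>k<N. w (int k + int (Suc i)) * y ^ k) = (\<Sum>k<N. h k)" by simp
    then have "y ^ i * (y * (\<Sum>k<N. w (int k + int (Suc i)) * y ^ k)) = poly W y"
      using Suc.IH by (simp only: h_def)
    then show ?case by (simp only: power_Suc mult_ac)
  qed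
  \<comment> \<open>The powers of \<open>inverse y\<close> are absorbed into the shifted sums;
    exchanging the summations then leaves the recurrence as the inner sum.\<close>
  have "poly p (inverse y) * poly W y = (\<Sum>i\<le>degree p. coeff p i * inverse y ^ i * poly W y)"
    by (simp add: poly_altdef sum_distrib_right)
  also have "\<dots> = (\<Sum>i\<le>degree p. coeff p i * (\<Sum>k<N. w (int k + int i) * y ^ k))"
  proof (rule sum.cong[OF refl])
    fix i
    have "inverse y ^ i * poly W y = inverse y ^ i * y ^ i * (\<Sum>k<N. w (int k + int i) * y ^ k)"
      using shift[of i] by (simp add: mult.assoc)
    also have "inverse y ^ i * y ^ i = 1" using y0 by (simp flip: power_mult_distrib)
    finally show "coeff p i * inverse y ^ i * poly W y
        = coeff p i * (\<Sum>k<N. w (int k + int i) * y ^ k)" by (simp add: mult.assoc)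
  qed
  also have "\<dots> = (\<Sum>k<N. (\<Sum>i\<le>degree p. coeff p i * w (int k + int i)) * y ^ k)"
    unfolding sum_distrib_left sum_distrib_right by (subst sum.swap) (simp add: mult.assoc)
  also have "\<dots> = 0" by (simp add: rec)
  finally have "poly p (inverse y) = 0" using y by simp
  moreover have "inverse y ^ N = 1" using y by (simp add: power_inverse)
  ultimately show ?thesis using that by blast
qed

section \<open>From weighted patterns to linear recurrences\<close>

lemma sum_coeff_degree_le:
  fixes h :: "nat \<Rightarrow> complex"
  assumes "degree p \<le> D"
  shows "(\<Sum>i\<le>D. of_int (coeff p i) * h i) = (\<Sum>i\<le>degree p. of_int (coeff p i) * h i)"
  using assms by (intro sum.mono_neutral_right) (auto simp: coeff_eq_0)

text \<open>The members of \<open>P\<close> are the translates of its canonical figure, whose points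
  are the exponents of the polynomial; the translate by \<open>s\<close> yields the recurrence at
  \<open>s\<close>.\<close>

lemma pattern_annihilation_iff:
  fixes w :: "int \<Rightarrow> complex"
  assumes P: "weighted_pattern P"
  shows "(\<forall>F\<in>P. (\<Sum>(x, g)\<in>F. w x * of_int g) = 0) \<longleftrightarrow>
    (\<forall>s. (\<Sum>i\<le>degree (pattern_poly P). of_int (coeff (pattern_poly P) i) * w (s + int i)) = 0)"
proof -
  define C where "C = canonical_figure P"
  have "is_canonical_figure P C"
    unfolding C_def canonical_figure_def by (rule theI'[OF canonical_figure_ex1[OF P]])
  then have CP: "C \<in> P" and nonneg: "\<And>u g. (u, g) \<in> C \<Longrightarrow> 0 \<le> u"
    by (auto simp: is_canonical_figure_def)
  obtain G where G: "finite G" "P = range (\<lambda>t. translate t G)"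
    using P by (auto simp: weighted_pattern_def weighted_figure_def)
  have tt: "translate s (translate t G) = translate (t + s) G" for s t
    unfolding translate_def by (auto simp: image_image case_prod_beta add.assoc)
  obtain t where t: "C = translate t G" using CP G by blast
  have finC: "finite C" using G by (simp add: t translate_def)
  have PC: "P = range (\<lambda>s. translate s C)"
  proof -
    have "translate s G = translate (s - t) C" for s by (simp add: t tt)
    then have "(\<lambda>s. translate s G) ` UNIV \<subseteq> range (\<lambda>s. translate s C)" by blast
    then show ?thesis unfolding G(2) by (auto simp: t tt)
  qed
  define p where "p = pattern_poly P"
  have p: "p = (\<Sum>(u, g)\<in>C. monom g (nat u))" by (simp add: p_def pattern_poly_def C_def)
  \<comment> \<open>A common summation bound: weights may be zero, so points of \<open>C\<close> can
    exceed \<open>degree p\<close>.\<close>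
  define D where "D = max (degree p) (Max (insert 0 ((\<lambda>(u, g). nat u) ` C)))"
  have uD: "nat u \<le> D" if "(u, g) \<in> C" for u g
  proof -
    have "nat u \<le> Max (insert 0 ((\<lambda>(u, g). nat u) ` C))"
      using that finC by (intro Max_ge) force+
    then show ?thesis by (simp add: D_def)
  qed
  have "(\<Sum>(x, g)\<in>translate s C. w x * of_int g)
     = (\<Sum>i\<le>degree p. of_int (coeff p i) * w (s + int i))" for s
  proof -
    have "inj_on (\<lambda>(u, g). (u + s, g)) C" by (auto intro!: inj_onI)
    then have "(\<Sum>(x, g)\<in>translate s C. w x * of_int g) = (\<Sum>(u, g)\<in>C. of_int g * w (s + u))"
      unfolding translate_def by (subst sum.reindex) (auto simp: case_prod_beta add.commute mult.commute)
    also have "\<dots> = (\<Sum>(u, g)\<in>C. \<Sum>i\<le>D. of_int (coeff (monom g (nat u)) i) * w (s + int i))"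
    proof (rule sum.cong[OF refl], clarify)
      fix u g assume ug: "(u, g) \<in> C"
      have "(\<Sum>i\<le>D. of_int (coeff (monom g (nat u)) i) * w (s + int i))
         = (\<Sum>i\<in>{nat u}. of_int (coeff (monom g (nat u)) i) * w (s + int i))"
        using uD[OF ug] by (intro sum.mono_neutral_right) auto
      then show "of_int g * w (s + u) = (\<Sum>i\<le>D. of_int (coeff (monom g (nat u)) i) * w (s + int i))"
        using nonneg[OF ug] by simp
    qed
    also have "\<dots> = (\<Sum>i\<le>D. of_int (coeff p i) * w (s + int i))"
      unfolding p case_prod_beta by (subst sum.swap) (simp add: coeff_sum sum_distrib_right)
    also have "\<dots> = (\<Sum>i\<le>degree p. of_int (coeff p i) * w (s + int i))"
      by (rule sum_coeff_degree_le) (simp add: D_def)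
    finally show ?thesis .
  qed
  then show ?thesis unfolding p_def[symmetric] by (subst PC) simp
qed

theorem theorem1:
  fixes P :: "(int \<times> int) set set"
  assumes "weighted_pattern P"
  shows "(\<exists>(A :: complex set) (w :: int \<Rightarrow> complex).
            finite A \<and> range w \<subseteq> A \<and> (\<exists>x. w x \<noteq> 0) \<and>
            (\<forall>F\<in>P. (\<Sum>(x, g)\<in>F. w x * of_int g) = 0))
     \<longleftrightarrow>
         (\<exists>n::nat. n > 0 \<and>
            (\<exists>\<Phi> :: rat poly. map_poly of_rat \<Phi> = cyclotomic_poly n \<and>
               \<Phi> dvd (map_poly of_int (pattern_poly P) :: rat poly)))"
  (is "?L \<longleftrightarrow> ?R")
proof
  define p where "p = pattern_poly P"
  define pc where "pc = (map_poly of_int p :: complex poly)"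
  have cpc: "coeff pc i = of_int (coeff p i)" for i by (simp add: pc_def coeff_map_poly)
  have dpc: "degree pc = degree p" unfolding pc_def by (rule degree_map_poly) simp
  have ip: "ipoly p z = poly pc z" for z by (simp add: ipoly_def pc_def)
  {
    assume ?L
    then obtain A w x where A: "finite A" "range w \<subseteq> A" and x: "w x \<noteq> (0::complex)"
      and ann: "\<forall>F\<in>P. (\<Sum>(x, g)\<in>F. w x * of_int g) = 0" by blast
    have fin: "finite (range w)" using A finite_subset by blast
    have rec: "(\<Sum>i\<le>degree pc. coeff pc i * w (s + int i)) = 0" for s
      using ann unfolding pattern_annihilation_iff[OF assms] by (simp add: cpc dpc p_def)
    have "\<exists>N z. N > 0 \<and> z ^ N = 1 \<and> poly pc z = 0"
    proof (cases "pc = 0")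
      case True
      \<comment> \<open>The zero polynomial vanishes at every root of unity; \<open>N = 1\<close>
        suffices.\<close>
      then show ?thesis by (intro exI[of _ 1]) simp
    next
      case False
      then obtain N where N: "N > 0" "\<And>s. w (s + int N) = w s"
        using recurrence_periodic[OF fin False rec] by blast
      then show ?thesis using periodic_recurrence_root_of_unity[OF N x rec] by blast
    qed
    then obtain n k where n: "n > 0" and k: "coprime k n" "poly pc (prim_root n ^ k) = 0"
      using root_of_unity_primitive by metis
    obtain f where f: "map_poly of_int f = cyclotomic_poly n"
      and fdvd: "\<And>g k. coprime k n \<Longrightarrow> ipoly g (prim_root n ^ k) = 0 \<Longrightarrow> f dvd g"
      using cyclotomic_minimal_poly[OF n] by blast
    have "f dvd p" using fdvd[OF k(1), of p] k(2) by (simp add: ip)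
    then have "(map_poly of_int f :: rat poly) dvd map_poly of_int p"
      by (auto simp: map_poly_of_int_mult elim!: dvdE)
    moreover have "map_poly of_rat (map_poly of_int f :: rat poly) = cyclotomic_poly n"
      unfolding f[symmetric] by (subst map_poly_map_poly) (simp_all add: o_def)
    ultimately show ?R using n unfolding p_def by blast
  }
  {
    assume ?R
    then obtain n \<Phi> where n: "n > 0" and Phi: "map_poly of_rat \<Phi> = cyclotomic_poly n"
      and dvd: "\<Phi> dvd (map_poly of_int p :: rat poly)" unfolding p_def by blast
    define z where "z = prim_root n"
    have zn: "z ^ n = 1" and z0: "z \<noteq> 0" using n by (simp_all add: z_def prim_root_power)
    obtain \<Psi> where Psi: "map_poly of_int p = \<Phi> * \<Psi>" using dvd by blast
    have "pc = map_poly of_rat (map_poly of_int p :: rat poly)"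
      unfolding pc_def by (subst map_poly_map_poly) (simp_all add: o_def)
    also have "\<dots> = map_poly of_rat \<Phi> * map_poly of_rat \<Psi>" unfolding Psi
      by (rule poly_eqI) (simp add: coeff_map_poly coeff_mult of_rat_sum of_rat_mult)
    finally have "poly pc z = poly (cyclotomic_poly n) z * poly (map_poly of_rat \<Psi>) z"
      by (simp add: Phi)
    \<comment> \<open>The factor with \<open>k = 1\<close> vanishes at \<open>z\<close>.\<close>
    moreover have "poly (cyclotomic_poly n) z = 0"
      unfolding cyclotomic_poly_def poly_prod
      by (rule prod_zero[OF _ bexI[of _ 1]])
        (use n in \<open>auto simp: z_def prim_root_def cis_conv_exp mult_ac\<close>)
    ultimately have pz: "poly pc z = 0" by simp
    \<comment> \<open>A geometric word: its values are \<open>n\<close>-th roots of unity, and the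
      recurrence sum at \<open>s\<close> factors as \<open>w s * poly pc z\<close>.\<close>
    define w where "w = (\<lambda>x::int. z powi x)"
    have "(w x) ^ n = 1" for x
      by (metis w_def zn power_int_power power_int_power' mult.commute power_int_1_left)
    then have "range w \<subseteq> {y. y ^ n = 1}" by auto
    \<comment> \<open>An infinite set has \<open>card\<close> 0 by convention, while this one has
      \<open>card\<close> \<open>n > 0\<close>.\<close>
    moreover have "finite {y::complex. y ^ n = 1}"
      using card_roots_unity_eq[OF n] n card.infinite by fastforce
    moreover have "w 0 \<noteq> 0" by (simp add: w_def)
    moreover have "(\<Sum>i\<le>degree p. of_int (coeff p i) * w (s + int i)) = 0" for s
    proof -
      have "(\<Sum>i\<le>degree p. of_int (coeff p i) * w (s + int i)) = w s * poly pc z"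
        using z0 by (simp add: w_def power_int_add poly_altdef dpc cpc sum_distrib_left mult_ac)
      then show ?thesis by (simp add: pz)
    qed
    ultimately show ?L unfolding pattern_annihilation_iff[OF assms] p_def[symmetric] by blast
  }
qed

end
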